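(* Let $n,k,t,s$ be positive integers with $k\geq t+1$ and $n\geq (t+1)\left(2(k-t+1)^{2}+7s\right)$. Suppose that $\mathcal{F},\mathcal{G}\subseteq \binom{[n]}{k}$ are $s$-almost cross-$t$-intersecting families such that $|\mathcal{F}||\mathcal{G}|$ is maximum among all pairs of $s$-almost cross-$t$-intersecting families in $\binom{[n]}{k}$. Then there exists $W\in\binom{[n]}{t}$ such that $\mathcal{F}=\mathcal{G}=\left\{H\in\binom{[n]}{k}: W\subseteq H\right\}$.
   Context: $[n]=\{1,\dots,n\}$ and $\binom{X}{k}$ denotes the family of all $k$-subsets of a set $X$. Two sets $F,G$ are $t$-intersecting if $|F\cap G|\geq t$ and $t$-disjoint otherwise. Two families $\mathcal{F},\mathcal{G}\subseteq\binom{[n]}{k}$ are $s$-almost cross-$t$-intersecting if each member of $\mathcal{F}$ is $t$-disjoint with at most $s$ members of $\mathcal{G}$, and each member of $\mathcal{G}$ is $t$-disjoint with at most $s$ members of $\mathcal{F}$. *)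

theory Defs
  imports "HOL-Library.Ramsey"
begin

definition t_intersecting :: "nat \<Rightarrow> 'a set \<Rightarrow> 'a set \<Rightarrow> bool" where
  "t_intersecting t F G \<longleftrightarrow> t \<le> card (F \<inter> G)"

abbreviation t_disjoint :: "nat \<Rightarrow> 'a set \<Rightarrow> 'a set \<Rightarrow> bool" where
  "t_disjoint t F G \<equiv> \<not> t_intersecting t F G"

(* The families of k-subsets of [n] are subsets of nsets {1..n} k; the definition includes
   this condition, so every cardinality below is that of a finite set. *)
definition almost_cross_intersecting ::
  "nat \<Rightarrow> nat \<Rightarrow> nat \<Rightarrow> nat \<Rightarrow> nat set set \<Rightarrow> nat set set \<Rightarrow> bool" where
  "almost_cross_intersecting n k s t \<F> \<G> \<longleftrightarrow>
     \<F> \<subseteq> nsets {1..n} k \<and> \<G> \<subseteq> nsets {1..n} k \<and>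
     (\<forall>F\<in>\<F>. card {G \<in> \<G>. t_disjoint t F G} \<le> s) \<and>
     (\<forall>G\<in>\<G>. card {F \<in> \<F>. t_disjoint t G F} \<le> s)"

end

theory Submission
  imports Defs
begin

text \<open>Call \<open>T\<close> a \<open>t\<close>-cover of a family if it \<open>t\<close>-intersects all its members. Put \<open>q = 2 (t + 1)\<close>,
  \<open>M = (n - t choose k - t)\<close>, and let \<open>t + a\<close> and \<open>t + b\<close> be the least sizes of \<open>t\<close>-covers of \<open>\<F>\<close> and
  \<open>\<G>\<close>, capped at \<open>k\<close>. If \<open>T\<close> is not a \<open>t\<close>-cover of \<open>\<G>\<close>, witnessed by \<open>G\<close>, then all but \<open>s\<close> of the
  members of \<open>\<F>\<close> above \<open>T\<close> meet a fixed set of \<open>k - t + 1\<close> elements of \<open>G - T\<close>. Branching over this set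
  until the size \<open>t + b\<close> is reached shows that at most \<open>M / q ^ b\<close> members of \<open>\<F>\<close> contain a given
  \<open>t\<close>-set. A smallest cover of \<open>\<F>\<close> has at most \<open>(t + 1) ^ a\<close> subsets of size \<open>t\<close>; if the cap is attained,
  a member of \<open>\<G>\<close> serves instead, at the price of \<open>s\<close> exceptions. So, up to these exceptions,
  \<open>card \<F> * card \<G>\<close> is at most \<open>M\<^sup>2 / 2 ^ (a + b)\<close>, which forces \<open>a = b = 0\<close>.
  If finally the \<open>t\<close>-set common to \<open>\<G>\<close> missed a member of \<open>\<F>\<close>, one branching step would already
  give \<open>card \<G> < M\<close>.\<close>

section \<open>Covers and the number of \<open>k\<close>-sets above a fixed set\<close>

lemma almost_cross_intersecting_commute:
  "almost_cross_intersecting n k s t \<F> \<G> \<longleftrightarrow> almost_cross_intersecting n k s t \<G> \<F>"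
  by (auto simp: almost_cross_intersecting_def)

lemma t_intersecting_iff_subset:
  assumes "finite T" "card T = t"
  shows "t_intersecting t T F \<longleftrightarrow> T \<subseteq> F"
proof
  assume "t_intersecting t T F"
  then have "card T \<le> card (T \<inter> F)"
    using assms by (simp add: t_intersecting_def)
  then have "T \<inter> F = T"
    using assms by (intro card_seteq) auto
  then show "T \<subseteq> F" by blast
next
  assume "T \<subseteq> F"
  then show "t_intersecting t T F"
    using assms by (simp add: t_intersecting_def Int_absorb2)
qed

lemma card_nsets_superset:
  assumes "finite X" "T \<subseteq> X" "card T \<le> k"
  shows "card {H \<in> nsets X k. T \<subseteq> H} = (card X - card T) choose (k - card T)"
proof -
  have fT: "finite T" using assms finite_subset by blast
  have "bij_betw (\<lambda>H. H - T) {H \<in> nsets X k. T \<subseteq> H} (nsets (X - T) (k - card T))"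
  proof (rule bij_betw_byWitness[where f' = "\<lambda>H. H \<union> T"])
    show "(\<lambda>H. H - T) ` {H \<in> nsets X k. T \<subseteq> H} \<subseteq> nsets (X - T) (k - card T)"
      using fT by (auto simp: nsets_def card_Diff_subset)
    show "(\<lambda>H. H \<union> T) ` nsets (X - T) (k - card T) \<subseteq> {H \<in> nsets X k. T \<subseteq> H}"
    proof clarify
      fix H assume H: "H \<in> nsets (X - T) (k - card T)"
      then have "card (H \<union> T) = card H + card T"
        using fT by (intro card_Un_disjoint) (auto simp: nsets_def)
      then show "H \<union> T \<in> nsets X k \<and> T \<subseteq> H \<union> T"
        using H assms fT by (auto simp: nsets_def)
    qed
  qed (auto simp: nsets_def)
  then show ?thesis
    using assms fT by (simp add: bij_betw_same_card card_nsets card_Diff_subset)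
qed

lemma card_superset_family_le:
  assumes "finite X" "\<F> \<subseteq> nsets X k" "T \<subseteq> X" "card T \<le> k"
  shows "card {F \<in> \<F>. T \<subseteq> F} \<le> (card X - card T) choose (k - card T)"
proof -
  have "card {F \<in> \<F>. T \<subseteq> F} \<le> card {H \<in> nsets X k. T \<subseteq> H}"
    using assms by (intro card_mono) (auto simp: finite_imp_finite_nsets)
  then show ?thesis using assms by (simp add: card_nsets_superset)
qed

section \<open>Binomial estimates\<close>

text \<open>The coefficient is the product of the factors \<open>(t + i) / i\<close> for
  \<open>i\<close> from \<open>1\<close> to \<open>a\<close>, each at most
  \<open>t + 1\<close>.\<close>

lemma choose_add_le_power: "(t + a) choose t \<le> (t + 1) ^ a"
proof (induction a)
  case (Suc a)
  have "Suc a * ((t + Suc a) choose t) = (t + Suc a) * ((t + a) choose t)"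
    using binomial_absorb_comp[of "t + Suc a" t] by simp
  also have "\<dots> \<le> (Suc a * (t + 1)) * (t + 1) ^ a"
    using Suc by (intro mult_mono) auto
  finally have "Suc a * ((t + Suc a) choose t) \<le> Suc a * (t + 1) ^ Suc a"
    by (simp only: power_Suc mult.assoc)
  then show ?case by (simp only: mult_le_cancel1)
qed simp

text \<open>Each induction step multiplies by \<open>m / (d + 1)\<close>, at least
  \<open>q * (d + 2) / (d + 1)\<close>. The prefactor \<open>d + 1\<close> is kept because it
  cancels the factor from the absorption identity in \<open>choose_ge_branching\<close>.\<close>

lemma choose_ge_power:
  fixes q :: nat
  assumes "(d + 1) * q \<le> m" "1 \<le> q"
  shows "(d + 1) * q ^ d \<le> m choose d"
  using assms
proof (induction d arbitrary: m)
  case (Suc d)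
  then obtain m' where m: "m = Suc m'"
    by (cases m) auto
  have "(d + 1) * q \<le> m'"
    using Suc.prems by (simp add: m)
  then have IH: "(d + 1) * q ^ d \<le> m' choose d"
    using Suc by blast
  have "Suc d * ((Suc d + 1) * q ^ Suc d) = ((Suc d + 1) * q) * ((d + 1) * q ^ d)"
    by (simp add: algebra_simps)
  also have "\<dots> \<le> m * (m' choose d)"
    using Suc.prems(1) IH by (intro mult_mono) auto
  also have "\<dots> = Suc d * (m choose Suc d)"
    using Suc_times_binomial[of d m'] by (simp only: m)
  finally show ?case by (simp only: mult_le_cancel1)
qed simp

text \<open>After multiplication by \<open>Suc d\<close>, absorption turns the right-hand side into
  \<open>Suc m * (m choose d)\<close>. One part of \<open>Suc m\<close> pays for the
  \<open>L\<close> branches, the other for the \<open>s\<close> exceptions.\<close>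

lemma choose_ge_branching:
  fixes q :: nat
  assumes "Suc d * q * L + q * s \<le> Suc m" "2 \<le> L" "1 \<le> q"
  shows "q * L * (m choose d) + s * q ^ Suc d \<le> Suc m choose Suc d"
proof -
  have "Suc d * q * 2 \<le> Suc d * q * L"
    using assms(2) by (intro mult_le_mono) auto
  moreover have "1 \<le> Suc d * q"
    using assms(3) by simp
  ultimately have "(d + 1) * q \<le> m"
    using assms(1) by simp
  then have "(d + 1) * q ^ d \<le> m choose d"
    using assms(3) by (rule choose_ge_power)
  then have "q * s * (Suc d * q ^ d) \<le> q * s * (m choose d)"
    by (intro mult_le_mono) auto
  then have "Suc d * (q * L * (m choose d) + s * q ^ Suc d)
      \<le> (Suc d * q * L + q * s) * (m choose d)"
    by (simp add: algebra_simps)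
  also have "\<dots> \<le> Suc m * (m choose d)"
    using assms(1) by (intro mult_le_mono) auto
  also have "\<dots> = Suc d * (Suc m choose Suc d)"
    by (rule Suc_times_binomial[symmetric])
  finally show ?thesis by (simp only: mult_le_cancel1)
qed

text \<open>This is the bookkeeping of one branching step from size \<open>t + j\<close> to
  \<open>t + Suc j\<close>, and the place where the lower bound on \<open>n\<close> enters.\<close>

lemma choose_ge_branching_of_bound:
  fixes n k t s :: nat
  assumes n: "(t + 1) * (2 * (k - t + 1)^2 + 7 * s) \<le> n" and j: "t + j < k"
  defines "q \<equiv> 2 * (t + 1)"
  shows "q * (k - t + 1) * ((n - (t + Suc j)) choose (k - (t + Suc j))) + s * q ^ (k - (t + j))
    \<le> (n - (t + j)) choose (k - (t + j))"
proof -
  obtain d where k: "k = t + Suc (j + d)"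
    using j less_iff_Suc_add by auto
  define L where "L = k - t + 1"
  have L: "L = Suc d + j + 1"
    by (simp add: L_def k)
  \<comment> \<open>Since \<open>L = Suc d + j + 1\<close>, the square leaves
    \<open>q * L * (j + 1)\<close> over, which pays for the \<open>t + j\<close> subtracted from
    \<open>n\<close>.\<close>
  have "Suc d * q * L + q * s + (t + j) \<le> q * L\<^sup>2 + (t + 1) * (7 * s)"
  proof -
    have "t + j \<le> q * L * (j + 1)"
    proof -
      have "t + j \<le> (t + 1) * (j + 1)" by simp
      also have "\<dots> \<le> q * L * (j + 1)"
        by (intro mult_le_mono) (auto simp: q_def L)
      finally show ?thesis .
    qed
    moreover have "q * L\<^sup>2 = Suc d * q * L + q * L * (j + 1)"
      unfolding power2_eq_square L by (simp add: algebra_simps)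
    moreover have "q * s \<le> (t + 1) * (7 * s)"
      by (simp add: q_def)
    ultimately show ?thesis by linarith
  qed
  also have "\<dots> \<le> n"
    using n by (simp add: q_def L_def algebra_simps)
  finally have bound: "Suc d * q * L + q * s \<le> n - (t + j)"
    by linarith
  moreover have "0 < Suc d * q * L"
    by (simp add: q_def L)
  ultimately obtain m where m: "n - (t + j) = Suc m"
    by (cases "n - (t + j)") auto
  have "q * L * (m choose d) + s * q ^ Suc d \<le> Suc m choose Suc d"
    using bound unfolding m by (rule choose_ge_branching) (auto simp: L q_def)
  moreover have "n - (t + Suc j) = m" "k - (t + Suc j) = d" "k - (t + j) = Suc d"
    using m by (auto simp: k)
  ultimately show ?thesis
    by (simp only: m L_def)
qed

section \<open>Branching and covers\<close>

text \<open>As \<open>T\<close> meets \<open>G\<close> in fewer than \<open>t\<close> elements,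
  \<open>G - T\<close> contains a set \<open>R\<close> of size \<open>k - t + 1\<close>. A set that
  avoids \<open>R\<close> meets \<open>G\<close> in at most \<open>t - 1\<close> elements, so it is
  one of the exceptions.\<close>

lemma card_superset_branching:
  assumes "finite \<F>" and G: "finite G" "card G = k" and t: "1 \<le> t" "t \<le> k"
    and disj: "t_disjoint t T G"
    and few: "card {F \<in> \<F>. t_disjoint t G F} \<le> s"
    and B: "\<And>x. x \<in> G - T \<Longrightarrow> card {F \<in> \<F>. insert x T \<subseteq> F} \<le> B"
  shows "card {F \<in> \<F>. T \<subseteq> F} \<le> s + (k - t + 1) * B"
proof -
  have "card G = card (T \<inter> G) + card (G - T)"
    using G by (metis Int_commute card_Int_Diff)
  then have "k - t + 1 \<le> card (G - T)"
    using disj G t unfolding t_intersecting_def by linarith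
  then obtain R where R: "R \<subseteq> G - T" "card R = k - t + 1" "finite R"
    by (rule obtain_subset_with_card_n)
  have "{F \<in> \<F>. T \<subseteq> F} \<subseteq> {F \<in> \<F>. t_disjoint t G F} \<union> (\<Union>x\<in>R. {F \<in> \<F>. insert x T \<subseteq> F})"
  proof clarsimp
    fix F assume F: "F \<in> \<F>" "T \<subseteq> F" "t_intersecting t G F" "\<forall>x\<in>R. x \<notin> F"
    then have "card (G \<inter> F) \<le> card (G - R)"
      using G by (intro card_mono) auto
    also have "card (G - R) = k - (k - t + 1)"
      using R G by (subst card_Diff_subset) auto
    finally show False
      using F(3) t by (simp add: t_intersecting_def)
  qed
  then have "card {F \<in> \<F>. T \<subseteq> F}
      \<le> card ({F \<in> \<F>. t_disjoint t G F} \<union> (\<Union>x\<in>R. {F \<in> \<F>. insert x T \<subseteq> F}))"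
    using assms(1) R by (intro card_mono) auto
  also have "\<dots> \<le> card {F \<in> \<F>. t_disjoint t G F} + card (\<Union>x\<in>R. {F \<in> \<F>. insert x T \<subseteq> F})"
    by (rule card_Un_le)
  also have "card (\<Union>x\<in>R. {F \<in> \<F>. insert x T \<subseteq> F}) \<le> (\<Sum>x\<in>R. card {F \<in> \<F>. insert x T \<subseteq> F})"
    using R by (intro card_UN_le)
  also have "\<dots> \<le> (k - t + 1) * B"
    using sum_bounded_above[of R "\<lambda>x. card {F \<in> \<F>. insert x T \<subseteq> F}" B] B R by auto
  finally show ?thesis using few by simp
qed

text \<open>Induction on \<open>b - j\<close>: at size \<open>t + b\<close> plain counting suffices,
  and each smaller size gains a factor \<open>2 * (t + 1)\<close> by branching over a
  \<open>G\<close> that is \<open>t\<close>-disjoint from \<open>T\<close>.\<close>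

lemma card_superset_decay:
  fixes n k t s :: nat
  assumes cross: "almost_cross_intersecting n k s t \<F> \<G>"
    and n: "(t + 1) * (2 * (k - t + 1)^2 + 7 * s) \<le> n" and t: "1 \<le> t"
    and b: "t + b \<le> k"
    and no_cover: "\<And>T. T \<subseteq> {1..n} \<Longrightarrow> t \<le> card T \<Longrightarrow> card T < t + b \<Longrightarrow> \<exists>G\<in>\<G>. t_disjoint t T G"
    and T: "T \<subseteq> {1..n}" "card T = t + j" "j \<le> b"
  shows "(2 * (t + 1)) ^ (b - j) * card {F \<in> \<F>. T \<subseteq> F} \<le> (n - (t + j)) choose (k - (t + j))"
  using T
proof (induction "b - j" arbitrary: j T)
  case 0
  have "card {F \<in> \<F>. T \<subseteq> F} \<le> (card {1..n} - card T) choose (k - card T)"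
    using 0 b cross by (intro card_superset_family_le) (auto simp: almost_cross_intersecting_def)
  with 0 show ?case by simp
next
  case (Suc i)
  define q where "q = 2 * (t + 1)"
  have q: "1 \<le> q" by (simp add: q_def)
  let ?N = "(n - (t + Suc j)) choose (k - (t + Suc j))"
  have j: "j < b" and i: "i = b - Suc j" using Suc.hyps(2) by auto
  have fin: "finite \<F>" "finite T"
    using cross Suc.prems(1)
    by (auto simp: almost_cross_intersecting_def finite_imp_finite_nsets intro: finite_subset)
  obtain G where G: "G \<in> \<G>" "t_disjoint t T G"
    using no_cover[of T] Suc.prems j by auto
  have Gk: "finite G" "card G = k" "G \<subseteq> {1..n}" "card {F \<in> \<F>. t_disjoint t G F} \<le> s"
    using G cross by (auto simp: almost_cross_intersecting_def nsets_def)
  have IH: "q ^ i * card {F \<in> \<F>. insert x T \<subseteq> F} \<le> ?N" if "x \<in> G - T" for x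
    unfolding i q_def using Suc.prems Gk(3) that j fin
    by (intro Suc.hyps(1)) (auto simp: i)
  \<comment> \<open>Rounding down is harmless: the counts are integers, and multiplying the quotient
    by \<open>q ^ i\<close> again gives at most \<open>?N\<close>.\<close>
  have "card {F \<in> \<F>. T \<subseteq> F} \<le> s + (k - t + 1) * (?N div q ^ i)"
  proof (rule card_superset_branching[where G = G])
    fix x assume "x \<in> G - T"
    from IH[OF this] q show "card {F \<in> \<F>. insert x T \<subseteq> F} \<le> ?N div q ^ i"
      by (simp add: less_eq_div_iff_mult_less_eq mult.commute)
  qed (use fin Gk G t b in auto)
  then have "q ^ Suc i * card {F \<in> \<F>. T \<subseteq> F} \<le> q ^ Suc i * (s + (k - t + 1) * (?N div q ^ i))"
    by (rule mult_le_mono2)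
  also have "\<dots> = s * q ^ Suc i + q * (k - t + 1) * (q ^ i * (?N div q ^ i))"
    by (simp add: algebra_simps)
  \<comment> \<open>Here \<open>Suc i = b - j\<close> is at most \<open>k - (t + j)\<close>, because
    \<open>t + b \<le> k\<close>.\<close>
  also have "\<dots> \<le> s * q ^ (k - (t + j)) + q * (k - t + 1) * ?N"
    using q b j by (intro add_mono mult_le_mono power_increasing) (auto simp: i)
  also have "\<dots> \<le> (n - (t + j)) choose (k - (t + j))"
    using choose_ge_branching_of_bound[OF n, of j] j b by (simp add: q_def)
  finally show ?case
    using Suc.hyps(2) by (simp only: q_def)
qed

text \<open>A member that \<open>t\<close>-intersects \<open>T\<close> contains one of the at most
  \<open>(t + 1) ^ a\<close> subsets of \<open>T\<close> of size \<open>t\<close>. The factor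
  \<open>c\<close> avoids division.\<close>

lemma card_le_of_cover:
  assumes "finite \<F>" "finite T" "card T = t + a"
    and B: "\<And>W. W \<subseteq> T \<Longrightarrow> card W = t \<Longrightarrow> c * card {F \<in> \<F>. W \<subseteq> F} \<le> B"
  shows "c * card \<F> \<le> c * card {F \<in> \<F>. t_disjoint t T F} + (t + 1) ^ a * B"
proof -
  have fin: "finite (nsets T t)"
    using assms(2) by (rule finite_imp_finite_nsets)
  have "\<F> \<subseteq> {F \<in> \<F>. t_disjoint t T F} \<union> (\<Union>W\<in>nsets T t. {F \<in> \<F>. W \<subseteq> F})"
  proof
    fix F assume F: "F \<in> \<F>"
    show "F \<in> {F \<in> \<F>. t_disjoint t T F} \<union> (\<Union>W\<in>nsets T t. {F \<in> \<F>. W \<subseteq> F})"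
    proof (cases "t_intersecting t T F")
      case True
      then obtain W where "W \<subseteq> T \<inter> F" "card W = t" "finite W"
        unfolding t_intersecting_def by (rule obtain_subset_with_card_n)
      then show ?thesis using F by (auto simp: nsets_def)
    qed (use F in simp)
  qed
  then have "card \<F> \<le> card ({F \<in> \<F>. t_disjoint t T F} \<union> (\<Union>W\<in>nsets T t. {F \<in> \<F>. W \<subseteq> F}))"
    using assms(1) fin by (intro card_mono) auto
  also have "\<dots> \<le> card {F \<in> \<F>. t_disjoint t T F} + card (\<Union>W\<in>nsets T t. {F \<in> \<F>. W \<subseteq> F})"
    by (rule card_Un_le)
  also have "card (\<Union>W\<in>nsets T t. {F \<in> \<F>. W \<subseteq> F}) \<le> (\<Sum>W\<in>nsets T t. card {F \<in> \<F>. W \<subseteq> F})"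
    using fin by (rule card_UN_le)
  finally have "c * card \<F> \<le> c * (card {F \<in> \<F>. t_disjoint t T F}
      + (\<Sum>W\<in>nsets T t. card {F \<in> \<F>. W \<subseteq> F}))"
    by simp
  also have "\<dots> = c * card {F \<in> \<F>. t_disjoint t T F}
      + (\<Sum>W\<in>nsets T t. c * card {F \<in> \<F>. W \<subseteq> F})"
    by (simp add: distrib_left sum_distrib_left)
  also have "(\<Sum>W\<in>nsets T t. c * card {F \<in> \<F>. W \<subseteq> F}) \<le> card (nsets T t) * B"
    using sum_bounded_above[of "nsets T t" "\<lambda>W. c * card {F \<in> \<F>. W \<subseteq> F}" B] B
    by (auto simp: nsets_def)
  also have "card (nsets T t) * B \<le> (t + 1) ^ a * B"
    using choose_add_le_power[of t a] assms by (intro mult_le_mono1) (simp add: card_nsets)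
  finally show ?thesis by simp
qed

lemma capped_cover_exists:
  assumes cross: "almost_cross_intersecting n k s t \<F> \<G>" and "\<G> \<noteq> {}" "t \<le> k"
  obtains a T where "t + a \<le> k" "T \<subseteq> {1..n}" "card T = t + a"
    "card {F \<in> \<F>. t_disjoint t T F} \<le> (if t + a = k then s else 0)"
    "\<And>T. T \<subseteq> {1..n} \<Longrightarrow> t \<le> card T \<Longrightarrow> card T < t + a \<Longrightarrow> \<exists>F\<in>\<F>. t_disjoint t T F"
proof -
  define P where "P a \<longleftrightarrow> t + a \<le> k \<and> (\<exists>T\<subseteq>{1..n}. card T = t + a \<and>
    card {F \<in> \<F>. t_disjoint t T F} \<le> (if t + a = k then s else 0))" for a
  have fin: "finite \<F>"
    using cross by (auto simp: almost_cross_intersecting_def finite_imp_finite_nsets intro: finite_subset)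
  obtain G where "G \<in> \<G>" using assms(2) by blast
  \<comment> \<open>At the cap a member of the other family serves as \<open>T\<close>, with at most
    \<open>s\<close> exceptions.\<close>
  then have "P (k - t)"
    using cross assms(3)
    by (auto simp: almost_cross_intersecting_def P_def nsets_def intro!: exI[of _ G])
  then have P: "P (LEAST a. P a)" by (rule LeastI)
  have min: "\<exists>F\<in>\<F>. t_disjoint t T F"
    if T: "T \<subseteq> {1..n}" "t \<le> card T" "card T < t + (LEAST a. P a)" for T
  proof (rule ccontr)
    assume "\<not> ?thesis"
    then have *: "{F \<in> \<F>. t_disjoint t T F} = {}" by blast
    have "card {F \<in> \<F>. t_disjoint t T F} = 0" unfolding * by simp
    \<comment> \<open>A genuine cover has no exceptions, so it is admissible on both sides of the
      cap.\<close>
    then have "P (card T - t)"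
      using T P by (auto simp: P_def intro!: exI[of _ T])
    then show False
      using T not_less_Least[of "card T - t" P] by linarith
  qed
  show thesis
    using P min that unfolding P_def by blast
qed

text \<open>The two families interact here: the cover of \<open>\<F>\<close> limits the choice of
  \<open>t\<close>-sets, while the lack of small covers of \<open>\<G>\<close> makes each of them
  lie in few members of \<open>\<F>\<close>.\<close>

lemma card_cross_bound:
  fixes n k t s :: nat
  assumes cross: "almost_cross_intersecting n k s t \<F> \<G>"
    and n: "(t + 1) * (2 * (k - t + 1)^2 + 7 * s) \<le> n" and t: "1 \<le> t"
    and b: "t + b \<le> k"
    and no_cover: "\<And>T. T \<subseteq> {1..n} \<Longrightarrow> t \<le> card T \<Longrightarrow> card T < t + b \<Longrightarrow> \<exists>G\<in>\<G>. t_disjoint t T G"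
    and T: "T \<subseteq> {1..n}" "card T = t + a" "card {F \<in> \<F>. t_disjoint t T F} \<le> s'"
  shows "(2 * (t + 1)) ^ b * card \<F> \<le> (2 * (t + 1)) ^ b * s' + (t + 1) ^ a * ((n - t) choose (k - t))"
proof -
  have fin: "finite \<F>" "finite T"
    using cross T(1)
    by (auto simp: almost_cross_intersecting_def finite_imp_finite_nsets intro: finite_subset)
  have "(2 * (t + 1)) ^ b * card \<F> \<le> (2 * (t + 1)) ^ b * card {F \<in> \<F>. t_disjoint t T F}
      + (t + 1) ^ a * ((n - t) choose (k - t))"
  proof (rule card_le_of_cover[OF fin T(2)])
    fix W assume "W \<subseteq> T" "card W = t"
    then show "(2 * (t + 1)) ^ b * card {F \<in> \<F>. W \<subseteq> F} \<le> (n - t) choose (k - t)"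
      using card_superset_decay[OF cross n t b no_cover, of W 0] T(1) by auto
  qed
  also have "\<dots> \<le> (2 * (t + 1)) ^ b * s' + (t + 1) ^ a * ((n - t) choose (k - t))"
    using T(3) by simp
  finally show ?thesis .
qed

section \<open>Numerical comparison with \<open>M * M\<close>\<close>

text \<open>Multiplying the bounds cancels the powers of \<open>t + 1\<close> and leaves
  \<open>2 ^ a * (x * y) \<le> M * (s + M)\<close>, where \<open>2 ^ a\<close> is at least
  \<open>2\<close> and \<open>s < M\<close>.\<close>

lemma product_less_one_capped:
  fixes t M s a b x y :: nat
  assumes x: "(2 * (t + 1)) ^ b * x \<le> (2 * (t + 1)) ^ b * s + (t + 1) ^ a * M"
    and y: "(2 * (t + 1)) ^ a * y \<le> (t + 1) ^ b * M"
    and "b < a" "s < M"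
  shows "x * y < M * M"
proof -
  define p r A B where "p = (t + 1) ^ a" and "r = (t + 1) ^ b"
    and "A = (2::nat) ^ a" and "B = (2::nat) ^ b"
  have pos: "0 < p" "0 < r" "1 \<le> B" and A: "2 \<le> A"
    using assms(3) by (auto simp: p_def r_def A_def B_def self_le_power)
  have rp: "r \<le> p"
    unfolding p_def r_def using assms(3) by (intro power_increasing) auto
  have x': "B * r * x \<le> B * r * s + p * M" and y': "A * p * y \<le> r * M"
    using x y by (simp_all only: power_mult_distrib p_def r_def A_def B_def)
  have "p * (A * B * (x * y)) = B * x * (A * p * y)" by simp
  also have "\<dots> \<le> B * x * (r * M)" using y' by (rule mult_le_mono2)
  also have "\<dots> = M * (B * r * x)" by simp
  also have "\<dots> \<le> M * (B * r * s + p * M)" using x' by (rule mult_le_mono2)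
  \<comment> \<open>Enlarging \<open>r\<close> to \<open>p\<close> and inserting a factor
    \<open>B\<close> makes \<open>p * B\<close> common to both terms.\<close>
  also have "\<dots> \<le> M * (B * p * s + p * (B * M))"
    using rp pos by (intro mult_le_mono add_mono) auto
  also have "\<dots> = p * (B * (M * (s + M)))" by (simp add: algebra_simps)
  finally have "A * B * (x * y) \<le> B * (M * (s + M))"
    using pos by simp
  then have "B * (A * (x * y)) \<le> B * (M * (s + M))"
    by (simp add: ac_simps)
  then have "A * (x * y) \<le> M * (s + M)"
    using pos by simp
  moreover have "2 * (x * y) \<le> A * (x * y)"
    using A by (rule mult_le_mono1)
  moreover have "M * (s + M) < 2 * (M * M)"
  proof -
    have "M * (s + M) < M * (2 * M)"
      using assms(4) by (intro mult_less_mono2) auto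
    then show ?thesis by simp
  qed
  ultimately show ?thesis by linarith
qed

lemma product_less_uncapped:
  fixes t M a b x y :: nat
  assumes x: "(2 * (t + 1)) ^ b * x \<le> (t + 1) ^ a * M"
    and y: "(2 * (t + 1)) ^ a * y \<le> (t + 1) ^ b * M"
    and ab: "0 < a + b" and M: "0 < M"
  shows "x * y < M * M"
proof -
  define p where "p = (t + 1) ^ (a + b)"
  have p: "0 < p" by (simp add: p_def)
  have "p * (2 ^ (a + b) * (x * y)) = ((2 * (t + 1)) ^ b * x) * ((2 * (t + 1)) ^ a * y)"
    unfolding p_def power_mult_distrib power_add by simp
  also have "\<dots> \<le> ((t + 1) ^ a * M) * ((t + 1) ^ b * M)"
    using x y by (rule mult_le_mono)
  also have "\<dots> = p * (M * M)"
    unfolding p_def power_add by simp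
  finally have "2 ^ (a + b) * (x * y) \<le> M * M"
    using p by simp
  moreover have "2 * (x * y) \<le> 2 ^ (a + b) * (x * y)"
    using ab by (intro mult_le_mono1) (simp add: self_le_power)
  moreover have "M * M < 2 * (M * M)"
    using M by simp
  ultimately show ?thesis by linarith
qed

text \<open>When both caps are attained, \<open>a = b\<close>, and each family can be bounded alone:
  cancelling \<open>(t + 1) ^ a\<close> gives \<open>x \<le> s + M / 2 ^ a\<close>.\<close>

lemma less_of_both_capped:
  fixes t M s a x :: nat
  assumes "(2 * (t + 1)) ^ a * x \<le> (2 * (t + 1)) ^ a * s + (t + 1) ^ a * M"
    and "0 < a" "2 * s < M"
  shows "x < M"
proof -
  have "(t + 1) ^ a * (2 ^ a * x) \<le> (t + 1) ^ a * (2 ^ a * s + M)"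
    using assms(1) unfolding power_mult_distrib by (simp only: distrib_left ac_simps)
  then have "2 ^ a * x \<le> 2 ^ a * s + M" by simp
  also have "\<dots> < 2 ^ a * s + 2 * (M - s)"
    using assms(3) by simp
  also have "\<dots> \<le> 2 ^ a * s + 2 ^ a * (M - s)"
    using assms(2) by (intro add_left_mono mult_le_mono1) (simp add: self_le_power)
  also have "\<dots> = 2 ^ a * M"
    using assms(3) by (simp flip: distrib_left)
  finally show ?thesis by simp
qed

section \<open>Stars and the extremal pair\<close>

lemma common_cover_of_large:
  fixes n k t s :: nat
  assumes cross: "almost_cross_intersecting n k s t \<F> \<G>"
    and n: "(t + 1) * (2 * (k - t + 1)^2 + 7 * s) \<le> n" and t: "1 \<le> t" "t < k" and s: "0 < s"
    and W: "W \<subseteq> {1..n}" "card W = t" "\<And>G. G \<in> \<G> \<Longrightarrow> W \<subseteq> G"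
    and large: "(n - t) choose (k - t) \<le> card \<G>" and F: "F \<in> \<F>"
  shows "W \<subseteq> F"
proof (rule ccontr)
  assume "\<not> W \<subseteq> F"
  have fin: "finite W" "finite \<G>" and \<G>: "\<G> \<subseteq> nsets {1..n} k"
    using cross W(1)
    by (auto simp: almost_cross_intersecting_def finite_imp_finite_nsets intro: finite_subset)
  have F': "finite F" "card F = k" "F \<subseteq> {1..n}" "card {G \<in> \<G>. t_disjoint t F G} \<le> s"
    using F cross by (auto simp: almost_cross_intersecting_def nsets_def)
  let ?N = "(n - (t + 1)) choose (k - (t + 1))"
  have "card {G \<in> \<G>. W \<subseteq> G} \<le> s + (k - t + 1) * ?N"
  proof (rule card_superset_branching[where G = F])
    show "t_disjoint t W F"
      using \<open>\<not> W \<subseteq> F\<close> fin W by (simp add: t_intersecting_iff_subset)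
    fix x assume "x \<in> F - W"
    then show "card {G \<in> \<G>. insert x W \<subseteq> G} \<le> ?N"
      using card_superset_family_le[of "{1..n}" \<G> k "insert x W"] \<G> W F'(3) fin t by auto
  qed (use fin F' t in auto)
  also have "{G \<in> \<G>. W \<subseteq> G} = \<G>" using W(3) by blast
  finally have "card \<G> \<le> s + (k - t + 1) * ?N" .
  also have "\<dots> < 2 * (t + 1) * (k - t + 1) * ?N + s * (2 * (t + 1)) ^ (k - t)"
  proof -
    \<comment> \<open>The strict inequality is drawn from the \<open>s\<close> term, as
      \<open>s\<close> is positive.\<close>
    have "1 < (2 * (t + 1)) ^ (k - t)"
      using t by (intro one_less_power) auto
    then have "s * 1 < s * (2 * (t + 1)) ^ (k - t)"
      using s by (rule mult_less_mono2)
    moreover have "1 * ((k - t + 1) * ?N) \<le> 2 * (t + 1) * ((k - t + 1) * ?N)"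
      by (rule mult_le_mono1) simp
    ultimately show ?thesis by (simp only: mult.assoc)
  qed
  also have "\<dots> \<le> (n - t) choose (k - t)"
    using choose_ge_branching_of_bound[OF n, of 0] t by simp
  finally show False using large by simp
qed

text \<open>Provides the competitor showing that the maximal product is at least
  \<open>M * M\<close>.\<close>

lemma star_almost_cross_intersecting:
  assumes "card W = t" "1 \<le> t"
  shows "almost_cross_intersecting n k s t
    {H \<in> nsets {1..n} k. W \<subseteq> H} {H \<in> nsets {1..n} k. W \<subseteq> H}"
proof -
  have "t_intersecting t F G" if "F \<in> nsets {1..n} k" "W \<subseteq> F" "W \<subseteq> G" for F G
  proof -
    have "card W \<le> card (F \<inter> G)"
      using that by (intro card_mono) (auto simp: nsets_def)
    then show ?thesis using assms by (simp add: t_intersecting_def)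
  qed
  then have "{G \<in> {H \<in> nsets {1..n} k. W \<subseteq> H}. t_disjoint t F G} = {}"
    if "F \<in> {H \<in> nsets {1..n} k. W \<subseteq> H}" for F
    using that by blast
  then have "card {G \<in> {H \<in> nsets {1..n} k. W \<subseteq> H}. t_disjoint t F G} \<le> s"
    if "F \<in> {H \<in> nsets {1..n} k. W \<subseteq> H}" for F
    using that by (simp only: card.empty)
  then show ?thesis
    unfolding almost_cross_intersecting_def by blast
qed

lemma eq_star_of_large:
  assumes "\<F> \<subseteq> nsets {1..n} k" "W \<subseteq> {1..n}" "card W \<le> k" "\<And>F. F \<in> \<F> \<Longrightarrow> W \<subseteq> F"
    and "(n - card W) choose (k - card W) \<le> card \<F>"
  shows "\<F> = {H \<in> nsets {1..n} k. W \<subseteq> H}"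
  using assms by (intro card_seteq) (auto simp: card_nsets_superset finite_imp_finite_nsets)

theorem theorem1p1:
  fixes n k t s :: nat and \<F> \<G> :: "nat set set"
  assumes "n > 0" and "k > 0" and "t > 0" and "s > 0"
    and "k \<ge> t + 1"
    and "n \<ge> (t + 1) * (2 * (k - t + 1)^2 + 7 * s)"
    and "almost_cross_intersecting n k s t \<F> \<G>"
    and "\<And>\<F>' \<G>'. almost_cross_intersecting n k s t \<F>' \<G>' \<Longrightarrow>
           card \<F>' * card \<G>' \<le> card \<F> * card \<G>"
  shows "\<exists>W \<in> nsets {1..n} t.
           \<F> = {H \<in> nsets {1..n} k. W \<subseteq> H} \<and> \<G> = {H \<in> nsets {1..n} k. W \<subseteq> H}"
proof -
  note cross = assms(7) and n = assms(6)
  have cross': "almost_cross_intersecting n k s t \<G> \<F>"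
    using cross by (simp add: almost_cross_intersecting_commute)
  have t: "1 \<le> t" "t < k" "t \<le> k" using assms by auto
  define M where "M = (n - t) choose (k - t)"
  \<comment> \<open>The exception term of the branching inequality at \<open>j = 0\<close> already
    gives \<open>4 * s \<le> M\<close>.\<close>
  have s2: "2 * s < M"
  proof -
    have "s * 4 \<le> s * (2 * (t + 1)) ^ (k - t)"
    proof -
      have "4 \<le> (2 * (t + 1)) ^ 1" using t by simp
      also have "\<dots> \<le> (2 * (t + 1)) ^ (k - t)"
        using t by (intro power_increasing) auto
      finally show ?thesis by simp
    qed
    also have "\<dots> \<le> M"
      using choose_ge_branching_of_bound[OF n, of 0] t by (simp add: M_def)
    finally show ?thesis using assms(4) by simp
  qed
  have tn: "t \<le> n"
  proof (rule ccontr)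
    assume "\<not> t \<le> n"
    then have "M = 0" using t by (simp add: M_def)
    then show False using s2 by simp
  qed
  have large: "M * M \<le> card \<F> * card \<G>"
  proof -
    have "card {H \<in> nsets {1..n} k. {1..t} \<subseteq> H} = M"
      using tn t card_nsets_superset[of "{1..n}" "{1..t}" k] by (simp add: M_def)
    then show ?thesis
      using assms(8)[OF star_almost_cross_intersecting[of "{1..t}" t]] t by simp
  qed
  have "0 < card \<F> * card \<G>"
    using s2 by (intro less_le_trans[OF _ large]) simp
  then have ne: "\<F> \<noteq> {}" "\<G> \<noteq> {}" by auto
  obtain a T where a: "t + a \<le> k" and T: "T \<subseteq> {1..n}" "card T = t + a"
    "card {F \<in> \<F>. t_disjoint t T F} \<le> (if t + a = k then s else 0)"
    and minT: "\<And>T. T \<subseteq> {1..n} \<Longrightarrow> t \<le> card T \<Longrightarrow> card T < t + a \<Longrightarrow> \<exists>F\<in>\<F>. t_disjoint t T F"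
    using capped_cover_exists[OF cross ne(2) t(3)] by blast
  obtain b U where b: "t + b \<le> k" and U: "U \<subseteq> {1..n}" "card U = t + b"
    "card {G \<in> \<G>. t_disjoint t U G} \<le> (if t + b = k then s else 0)"
    and minU: "\<And>T. T \<subseteq> {1..n} \<Longrightarrow> t \<le> card T \<Longrightarrow> card T < t + b \<Longrightarrow> \<exists>G\<in>\<G>. t_disjoint t T G"
    using capped_cover_exists[OF cross' ne(1) t(3)] by blast
  note x = card_cross_bound[OF cross n t(1) b minU T, folded M_def]
  note y = card_cross_bound[OF cross' n t(1) a minT U, folded M_def]
  have ab: "a = 0 \<and> b = 0"
  proof (rule ccontr)
    assume nz: "\<not> (a = 0 \<and> b = 0)"
    consider "t + a = k" "t + b = k" | "t + a = k" "t + b < k" | "t + a < k" "t + b = k"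
      | "t + a < k" "t + b < k"
      using a b by linarith
    then have "card \<F> * card \<G> < M * M"
    proof cases
      case 1
      then have "a = b" "0 < a" using t by auto
      then have "card \<F> < M" "card \<G> < M"
        using less_of_both_capped[of t a _ s M] x y 1 s2 by auto
      then show ?thesis by (rule mult_strict_mono') auto
    next
      case 2
      then show ?thesis
        using product_less_one_capped[of t b "card \<F>" s a M "card \<G>"] x y s2 by simp
    next
      case 3
      then show ?thesis
        using product_less_one_capped[of t a "card \<G>" s b M "card \<F>"] x y s2
        by (simp add: mult.commute)
    next
      case 4
      then show ?thesis
        using product_less_uncapped[of t b "card \<F>" a M "card \<G>"] x y nz s2 by simp
    qed
    then show False using large by simp
  qed
  have fin: "finite \<F>" "finite \<G>" "finite T" "finite U"
    using cross T(1) U(1)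
    by (auto simp: almost_cross_intersecting_def finite_imp_finite_nsets intro: finite_subset)
  \<comment> \<open>With \<open>a = b = 0\<close> and \<open>t < k\<close> the cap is not attained,
    so no exceptions are allowed.\<close>
  have "{F \<in> \<F>. t_disjoint t T F} = {}" "{G \<in> \<G>. t_disjoint t U G} = {}"
    using ab T(3) U(3) t fin by (auto simp: card_eq_0_iff)
  then have UG: "\<And>G. G \<in> \<G> \<Longrightarrow> U \<subseteq> G"
    using ab U(2) fin by (auto simp: t_intersecting_iff_subset)
  have M: "card \<F> \<le> M" "card \<G> \<le> M"
    using x y ab t by auto
  \<comment> \<open>Both sizes are at most \<open>M\<close> and their product is at least
    \<open>M * M\<close>, so neither can be smaller than \<open>M\<close>.\<close>
  have MF: "M \<le> card \<F>" and MG: "M \<le> card \<G>"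
  proof -
    have "M * M \<le> card \<F> * M" "M * M \<le> M * card \<G>"
      using large M by (meson le_trans mult_le_mono1 mult_le_mono2)+
    then show "M \<le> card \<F>" "M \<le> card \<G>"
      using s2 by auto
  qed
  have U': "card U = t" "U \<in> nsets {1..n} t"
    using U ab fin by (auto simp: nsets_def)
  have UF: "U \<subseteq> F" if "F \<in> \<F>" for F
    using common_cover_of_large[OF cross n t(1,2) assms(4) U(1) U'(1) UG MG[unfolded M_def] that] .
  have \<F>: "\<F> = {H \<in> nsets {1..n} k. U \<subseteq> H}"
    using cross U(1) U' t UF MF
    by (intro eq_star_of_large) (auto simp: almost_cross_intersecting_def M_def)
  have \<G>: "\<G> = {H \<in> nsets {1..n} k. U \<subseteq> H}"
    using cross U(1) U' t UG MG
    by (intro eq_star_of_large) (auto simp: almost_cross_intersecting_def M_def)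
  show ?thesis
    using U'(2) \<F> \<G> by (intro bexI[of _ U] conjI)
qed

end
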